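(* Let $s\geq 4$. No antipodal plane of order $s$ can be embedded in a Desarguesian projective plane $\mathrm{PG}(2,q)$, for any prime power $q$.
   Context: An antipodal plane of order $s\geq 2$ is a partial linear space $(\mathcal{P},\mathcal{L})$ (each line a subset of $\mathcal{P}$ of size at least $2$, two distinct points on at most one line) with $|\mathcal{P}|=|\mathcal{L}|=s^2+s+2$, every line containing $s+1$ points and every point on $s+1$ lines. An incidence structure $(\mathcal{P},\mathcal{L})$ is embedded in a projective plane $\Pi$ if there are injective maps $\phi$ from $\mathcal{P}$ to the points of $\Pi$ and $\psi$ from $\mathcal{L}$ to the lines of $\Pi$ which preserve incidence and non-incidence. *)

theory Defs
  imports "HOL-Analysis.Cartesian_Space"
begin

definition partial_linear_space :: "'p set \<Rightarrow> 'p set set \<Rightarrow> bool" where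
  "partial_linear_space P L \<longleftrightarrow>
     (\<forall>l\<in>L. l \<subseteq> P \<and> (\<exists>x\<in>l. \<exists>y\<in>l. x \<noteq> y)) \<and>
     (\<forall>x\<in>P. \<forall>y\<in>P. x \<noteq> y \<longrightarrow>
        (\<forall>l\<in>L. \<forall>m\<in>L. x \<in> l \<and> y \<in> l \<and> x \<in> m \<and> y \<in> m \<longrightarrow> l = m))"

definition antipodal_plane :: "nat \<Rightarrow> 'p set \<Rightarrow> 'p set set \<Rightarrow> bool" where
  "antipodal_plane s P L \<longleftrightarrow>
     s \<ge> 2 \<and> partial_linear_space P L \<and>
     card P = s^2 + s + 2 \<and> card L = s^2 + s + 2 \<and>
     (\<forall>l\<in>L. card l = s + 1) \<and>
     (\<forall>x\<in>P. card {l \<in> L. x \<in> l} = s + 1)"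

definition embedded_in ::
  "'p set \<Rightarrow> 'p set set \<Rightarrow> 'a set \<Rightarrow> 'b set \<Rightarrow> ('a \<Rightarrow> 'b \<Rightarrow> bool) \<Rightarrow> bool" where
  "embedded_in P L Pts Lns I \<longleftrightarrow>
     (\<exists>\<phi> \<psi>. \<phi> ` P \<subseteq> Pts \<and> inj_on \<phi> P \<and> \<psi> ` L \<subseteq> Lns \<and> inj_on \<psi> L \<and>
        (\<forall>x\<in>P. \<forall>l\<in>L. I (\<phi> x) (\<psi> l) \<longleftrightarrow> x \<in> l))"

text \<open>
  The plane PG(2,K) over a field K: the points and lines are the subspaces of K^3 of
  vector-space dimension 1 and 2, and incidence is inclusion. For K finite with q elements this
  is PG(2,q).
\<close>

definition pg2_points :: "('k::field ^ 3) set set" where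
  "pg2_points = {U. vec.subspace U \<and> vec.dim U = 1}"

definition pg2_lines :: "('k::field ^ 3) set set" where
  "pg2_lines = {W. vec.subspace W \<and> vec.dim W = 2}"

end

theory Submission
  imports Defs
begin

text \<open>
  Every point x has a unique non-collinear point x', every line l a unique disjoint line l', and
  x lies on l iff x' lies on l'. Fix a point a and let l range over the pencil of a. In
  coordinates where a and a' are the two points at infinity of the axes, the lines through a are
  horizontal at heights b(l) and their antipodes are vertical at abscissae c(l), so the remaining points
  form the grid (c(l), b(m)) with l and m distinct, and (c(l), b(m)), (c(m), b(l)) are antipodal.
  The remaining lines are affine maps from the set C of all c(l) onto the set B of all b(l) that
  never send c(l) to b(l), and any two grid points that are neither antipodal nor on a common
  line through a or a' lie on such a line.

  There are so many of these maps that, for each l, the scalings about c(l) preserving C are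
  transitive on the rest of C, and some affine map from C onto B sends c(l) to b(l). Hence every
  affine map sending c(l) to b(l) and some c(m) to b(n) maps C onto B. As it is not a line, it
  must induce an involution of the pencil, so it sends c(n) to b(m). This says that
  (b(m) - b(l)) (c(m) - c(l)) is a constant. Eliminating b, all but two elements of C correspond
  to roots t of a single quadratic t^2 + d t + d^2, so C has at most four elements.
\<close>

section \<open>Affine maps between indexed subsets of a field, and the bound on the grid\<close>

text \<open>The affine map of slope r that sends c x to b y maps c ` I onto b ` I.\<close>
definition scales_onto :: "'i set \<Rightarrow> ('i \<Rightarrow> 'k::field) \<Rightarrow> ('i \<Rightarrow> 'k) \<Rightarrow> 'i \<Rightarrow> 'i \<Rightarrow> 'k \<Rightarrow> bool" where
  "scales_onto I c b x y r \<longleftrightarrow>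
     r \<noteq> 0 \<and> (\<lambda>z. r * (c z - c x)) ` I = (\<lambda>w. b w - b y) ` I"

text \<open>Composition of the first map, the inverse of the second and the third:
  \<open>c x\<close> goes to \<open>b y\<close>, back to \<open>c' x'\<close>, and on to
  \<open>b y'\<close>. It later produces maps with prescribed fixed index.\<close>

lemma scales_onto_compose:
  assumes "scales_onto I c b x y r" "scales_onto I c' b x' y r'" "scales_onto I c' b x' y' t"
  shows "scales_onto I c b x y' (t / r' * r)"
proof -
  have ne: "r \<noteq> 0" "r' \<noteq> 0" "t \<noteq> 0"
    using assms by (auto simp: scales_onto_def)
  have "(\<lambda>z. t / r' * r * (c z - c x)) ` I = (\<lambda>d. t / r' * d) ` (\<lambda>z. r * (c z - c x)) ` I"
    by (simp add: image_image mult.assoc)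
  also have "\<dots> = (\<lambda>d. t / r' * d) ` (\<lambda>z. r' * (c' z - c' x')) ` I"
    using assms by (simp add: scales_onto_def)
  also have "\<dots> = (\<lambda>z. t * (c' z - c' x')) ` I"
    using ne by (simp add: image_image)
  also have "\<dots> = (\<lambda>w. b w - b y') ` I"
    using assms by (simp add: scales_onto_def)
  finally show ?thesis
    using ne by (simp add: scales_onto_def)
qed

text \<open>The second map followed by the inverse of the first returns \<open>c x\<close> to
  itself.\<close>

lemma scales_onto_self:
  assumes "scales_onto I c b x y r" "scales_onto I c b x y t"
  shows "scales_onto I c c x x (t / r)"
proof -
  have ne: "r \<noteq> 0" "t \<noteq> 0"
    using assms by (auto simp: scales_onto_def)
  have "(\<lambda>z. t / r * (c z - c x)) ` I = (\<lambda>d. d / r) ` (\<lambda>z. t * (c z - c x)) ` I"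
    by (simp add: image_image)
  also have "\<dots> = (\<lambda>d. d / r) ` (\<lambda>z. r * (c z - c x)) ` I"
    using assms by (simp add: scales_onto_def)
  also have "\<dots> = (\<lambda>z. c z - c x) ` I"
    using ne by (simp add: image_image)
  finally show ?thesis
    using ne by (simp add: scales_onto_def)
qed

lemma ex_not_in_small:
  assumes "card A < card B" "finite A"
  shows "\<exists>x\<in>B. x \<notin> A"
  using assms by (meson card_mono not_le subsetI)

text \<open>The scalings about \<open>c x\<close> that preserve the set of all values of
  \<open>c\<close> form a group acting freely on the other values. Each orbit has at least
  \<open>card T\<close> elements, too many for a second orbit.\<close>

lemma scales_onto_transitive:
  assumes fin: "finite I" and inj: "inj_on c I" and card: "card I \<ge> 4"
    and x: "x \<in> I"
    and many: "finite T" "card T + 2 \<ge> card I" "\<And>r. r \<in> T \<Longrightarrow> scales_onto I c c x x r"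
    and uv: "u \<in> I" "v \<in> I" "u \<noteq> x" "v \<noteq> x"
  shows "\<exists>t. scales_onto I c c x x t \<and> t * (c u - c x) = c v - c x"
proof (rule ccontr)
  assume contra: "\<not> ?thesis"
  define D where "D = (\<lambda>z. c z - c x) ` (I - {x})"
  have "inj_on (\<lambda>z. c z - c x) (I - {x})"
    using inj by (auto simp: inj_on_def)
  then have cD: "card D = card I - 1"
    unfolding D_def using x fin by (simp add: card_image)
  have finD: "finite D"
    using fin by (simp add: D_def)
  have ne: "c u - c x \<noteq> 0" "c v - c x \<noteq> 0"
    using uv x inj by (auto dest: inj_onD)
  have sub: "(\<lambda>r. r * (c w - c x)) ` T \<subseteq> D" if "w \<in> I" "w \<noteq> x" for w
  proof
    fix d assume "d \<in> (\<lambda>r. r * (c w - c x)) ` T"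
    then obtain r where r: "r \<in> T" "d = r * (c w - c x)" by auto
    then have "d \<in> (\<lambda>w. c w - c x) ` I"
      using many(3)[of r] that unfolding scales_onto_def by blast
    moreover have "d \<noteq> 0"
      using r many(3)[of r] that x inj unfolding scales_onto_def by (auto dest: inj_onD)
    ultimately show "d \<in> D" by (auto simp: D_def)
  qed
  have "(\<lambda>r. r * (c u - c x)) ` T \<inter> (\<lambda>r. r * (c v - c x)) ` T = {}"
  proof (rule ccontr)
    assume "\<not> ?thesis"
    then obtain r t where rt: "r \<in> T" "t \<in> T" "r * (c u - c x) = t * (c v - c x)" by blast
    have "scales_onto I c c x x (r / t)"
      by (rule scales_onto_self[OF many(3)[OF rt(2)] many(3)[OF rt(1)]])
    moreover have "t \<noteq> 0"
      using many(3)[OF rt(2)] by (simp add: scales_onto_def)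
    then have "r / t * (c u - c x) = c v - c x"
      using rt(3) by (simp add: field_simps)
    ultimately show False using contra by blast
  qed
  then have "card ((\<lambda>r. r * (c u - c x)) ` T \<union> (\<lambda>r. r * (c v - c x)) ` T) = card T + card T"
    using many(1) ne by (subst card_Un_disjoint) (auto simp: card_image inj_on_def)
  moreover have "card ((\<lambda>r. r * (c u - c x)) ` T \<union> (\<lambda>r. r * (c v - c x)) ` T) \<le> card D"
    using sub uv finD by (intro card_mono) auto
  \<comment> \<open>Two disjoint orbits of card I - 2 elements each do not fit into card I - 1 elements.\<close>
  ultimately show False using cD many(2) card by linarith
qed

text \<open>The embedding stripped to coordinates: indices stand for the lines of a pencil, and
  (\<open>c x\<close>, \<open>b y\<close>) with \<open>x \<noteq> y\<close> are the grid points. The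
  hypothesis \<open>line\<close> joins two of them in distinct columns and rows that are not
  antipodal; \<open>w \<noteq> z\<close> says that the joining line avoids the diagonal.\<close>

lemma affine_grid_card_le_4:
  fixes c b :: "'i \<Rightarrow> 'k::field"
  assumes inj_c: "inj_on c I" and inj_b: "inj_on b I"
    and line: "\<And>x y u v. \<lbrakk>x \<in> I; y \<in> I; u \<in> I; v \<in> I; x \<noteq> y; u \<noteq> v; x \<noteq> u; y \<noteq> v; \<not> (x = v \<and> y = u)\<rbrakk>
      \<Longrightarrow> \<exists>r m. r * c x + m = b y \<and> r * c u + m = b v \<and>
             (\<forall>z\<in>I. \<exists>w\<in>I. w \<noteq> z \<and> r * c z + m = b w)"
  shows "card I \<le> 4"
proof (rule ccontr)
  assume "\<not> card I \<le> 4"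
  then have card: "card I \<ge> 5" by simp
  then have fin: "finite I" using card.infinite by fastforce
  have pick: "\<exists>z\<in>I. z \<notin> set xs" if "length xs < 5" for xs
    using that card card_length[of xs] by (intro ex_not_in_small) auto
  have c_eq: "c x = c y \<longleftrightarrow> x = y" and b_eq: "b x = b y \<longleftrightarrow> x = y" if "x \<in> I" "y \<in> I" for x y
    using that inj_c inj_b by (auto dest: inj_onD)

  have slope: "scales_onto I c b x y ((b v - b y) / (c u - c x))"
    if h: "x \<in> I" "y \<in> I" "u \<in> I" "v \<in> I" "x \<noteq> y" "u \<noteq> v" "x \<noteq> u" "y \<noteq> v" "\<not> (x = v \<and> y = u)"
    for x y u v
  proof -
    obtain r m where rm: "r * c x + m = b y" "r * c u + m = b v"
        "\<forall>z\<in>I. \<exists>w\<in>I. w \<noteq> z \<and> r * c z + m = b w"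
      using line[OF h] by blast
    have diff: "r * (c z - c x) = r * c z + m - b y" for z
      by (simp add: algebra_simps flip: rm(1))
    have r: "(b v - b y) / (c u - c x) = r"
      using diff[of u] rm(2) c_eq[OF h(1,3)] h(7) by (simp add: field_simps)
    have r0: "r \<noteq> 0"
      using rm b_eq[OF h(2,4)] h(8) by auto
    have "(\<lambda>z. r * (c z - c x)) ` I = (\<lambda>w. b w - b y) ` I"
    \<comment> \<open>The hypothesis \<open>line\<close> yields only an inclusion; equal finite
      cardinalities make it an equality.\<close>
    proof (rule card_subset_eq)
      show "(\<lambda>z. r * (c z - c x)) ` I \<subseteq> (\<lambda>w. b w - b y) ` I"
        using rm(3) by (auto simp: diff)
      have "inj_on (\<lambda>z. r * (c z - c x)) I" "inj_on (\<lambda>w. b w - b y) I"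
        using r0 inj_c inj_b by (auto simp: inj_on_def)
      then show "card ((\<lambda>z. r * (c z - c x)) ` I) = card ((\<lambda>w. b w - b y) ` I)"
        by (simp add: card_image)
    qed (use fin in simp)
    then show ?thesis using r r0 by (simp add: scales_onto_def)
  qed

  have slope_ex: "\<exists>r. scales_onto I c b x y r" if "x \<in> I" "y \<in> I" "x \<noteq> y" for x y
  proof -
    obtain u where u: "u \<in> I" "u \<noteq> x" "u \<noteq> y" using pick[of "[x, y]"] by auto
    obtain v where v: "v \<in> I" "v \<noteq> x" "v \<noteq> y" "v \<noteq> u" using pick[of "[x, y, u]"] by auto
    show ?thesis using slope[of x y u v] that u v by blast
  qed

  have trans: "\<exists>t. scales_onto I c c x x t \<and> t * (c u - c x) = c v - c x"
    if h: "x \<in> I" "u \<in> I" "v \<in> I" "u \<noteq> x" "v \<noteq> x" for x u v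
  proof -
    obtain y where y: "y \<in> I" "y \<noteq> x" using pick[of "[x]"] by auto
    obtain w where w: "w \<in> I" "w \<noteq> x" "w \<noteq> y" using pick[of "[x, y]"] by auto
    \<comment> \<open>Slopes of the lines from (\<open>c x\<close>, \<open>b y\<close>) into the
      fixed column \<open>w\<close>. The values \<open>v = y\<close> (same row) and
      \<open>v = w\<close> (diagonal) are excluded, which leaves \<open>card I - 2\<close> slopes;
      their quotients by one of them are self-scalings about \<open>c x\<close>.\<close>
    define f where "f = (\<lambda>v. (b v - b y) / (c w - c x))"
    have cw: "c w - c x \<noteq> 0" using c_eq w h by auto
    have f: "scales_onto I c b x y (f v)" if "v \<in> I - {y, w}" for v
      unfolding f_def using slope[of x y w v] that h y w by blast
    obtain v0 where v0: "v0 \<in> I - {y, w}" using pick[of "[y, w]"] by auto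
    have f0: "f v0 \<noteq> 0" using f[OF v0] by (simp add: scales_onto_def)
    define T where "T = (\<lambda>v. f v / f v0) ` (I - {y, w})"
    have "inj_on (\<lambda>v. f v / f v0) (I - {y, w})"
      using f0 cw inj_b by (auto simp: inj_on_def f_def)
    then have "card T = card I - 2"
      using y w fin by (simp add: T_def card_image card_Diff_subset)
    moreover have "scales_onto I c c x x r" if "r \<in> T" for r
      using that f v0 scales_onto_self unfolding T_def by fastforce
    ultimately show ?thesis
      using h fin inj_c card
      by (intro scales_onto_transitive[where T = T]) (auto simp: T_def)
  qed

  have fixed: "\<exists>r. scales_onto I c b x x r" if x: "x \<in> I" for x
  proof -
    obtain z where z: "z \<in> I" "z \<noteq> x" using pick[of "[x]"] by auto
    obtain w where w: "w \<in> I" "w \<noteq> x" "w \<noteq> z" using pick[of "[x, z]"] by auto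
    \<comment> \<open>The detour is from \<open>c x\<close> to \<open>b w\<close>, back to
      \<open>c z\<close>, then to \<open>b x\<close>.\<close>
    show ?thesis
      using slope_ex[of x w] slope_ex[of z w] slope_ex[of z x] x z w scales_onto_compose by metis
  qed

  define G where "G = (\<lambda>x y. (b x - b y) * (c x - c y))"
  have G_sym: "G x y = G y x" for x y
    by (simp add: G_def algebra_simps)
  \<comment> \<open>The affine map sending c p to b p and c x to b y fixes the index p, so it is not one of
    the lines; hence its permutation of I is an involution and it sends c y to b x.\<close>
  have G_const: "G y p = G x p"
    if h: "p \<in> I" "x \<in> I" "y \<in> I" "x \<noteq> y" "x \<noteq> p" "y \<noteq> p" for p x y
  proof -
    obtain r where r: "scales_onto I c b p p r" using fixed h by blast
    define k where "k = (b y - b p) / (c x - c p)"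
    have cx: "c x - c p \<noteq> 0" and cxy: "c x \<noteq> c y"
      using c_eq h by auto
    have k0: "k \<noteq> 0" using b_eq h cx by (auto simp: k_def)
    have kx: "k * (c x - c p) = b y - b p" using cx by (simp add: k_def)
    \<comment> \<open>The slope \<open>k\<close> is factored as \<open>r * t\<close>: a self-scaling
      \<open>t\<close> about \<open>c p\<close> moves \<open>c x\<close> to the \<open>c z\<close>
      that \<open>r\<close> sends to \<open>b y\<close>. Hence the map of slope \<open>k\<close>
      also sends values of \<open>c\<close> to values of \<open>b\<close>.\<close>
    have "b y - b p \<in> (\<lambda>z. r * (c z - c p)) ` I"
      using r h unfolding scales_onto_def by auto
    then obtain z where z: "z \<in> I" "b y - b p = r * (c z - c p)" by auto
    have "z \<noteq> p" using z b_eq h by auto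
    then obtain t where t: "scales_onto I c c p p t" "t * (c x - c p) = c z - c p"
      using trans h z by blast
    have "k * (c x - c p) = r * t * (c x - c p)"
      using kx z t by simp
    then have krt: "k = r * t" using cx by simp
    have "t * (c y - c p) \<in> (\<lambda>w. c w - c p) ` I"
      using t(1) h unfolding scales_onto_def by blast
    then obtain z' where z': "z' \<in> I" "t * (c y - c p) = c z' - c p" by auto
    have "r * (c z' - c p) \<in> (\<lambda>w. b w - b p) ` I"
      using r z' unfolding scales_onto_def by blast
    then obtain v where v: "v \<in> I" "k * (c y - c p) = b v - b p"
      using krt z' by (auto simp: mult.assoc)
    have vy: "v \<noteq> y"
    proof
      assume "v = y"
      then have "k * (c y - c p) = k * (c x - c p)" using v kx by simp
      then show False using k0 cxy by simp
    qed
    have "v = x"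
    proof (rule ccontr)
      \<comment> \<open>Otherwise \<open>line\<close> applies to (\<open>c x\<close>,
        \<open>b y\<close>) and (\<open>c y\<close>, \<open>b v\<close>). The line it gives has
        slope \<open>k\<close>, so it passes through the forbidden diagonal point
        (\<open>c p\<close>, \<open>b p\<close>).\<close>
      assume vx: "v \<noteq> x"
      obtain q m where qm: "q * c x + m = b y" "q * c y + m = b v"
          "\<forall>z\<in>I. \<exists>w\<in>I. w \<noteq> z \<and> q * c z + m = b w"
        using line[of x y y v] h v(1) vx vy by metis
      have "q * (c x - c y) = (q * c x + m) - (q * c y + m)"
        by (simp add: algebra_simps)
      also have "\<dots> = k * (c x - c p) - k * (c y - c p)"
        unfolding qm(1,2) kx v(2) by simp
      also have "\<dots> = k * (c x - c y)"
        by (simp add: algebra_simps)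
      finally have "q * (c x - c y) = k * (c x - c y)" .
      then have qk: "q = k" using cxy by simp
      have "q * c p + m = (q * c x + m) - k * (c x - c p)"
        by (simp add: qk algebra_simps)
      then have "q * c p + m = b p"
        unfolding qm(1) kx by simp
      then show False using qm(3) h b_eq by metis
    qed
    then have "k * (c y - c p) = b x - b p" using v by simp
    moreover have "k * (c x - c p) * (c y - c p) = k * (c y - c p) * (c x - c p)"
      by simp
    ultimately show ?thesis using kx by (simp add: G_def)
  qed

  obtain i where i: "i \<in> I" using pick[of "[]"] by auto
  obtain j where j: "j \<in> I" "j \<noteq> i" using pick[of "[i]"] by auto
  define a where "a = c i - c j"
  have root: "(c j - c z) ^ 2 + a * (c j - c z) + a ^ 2 = 0"
    if z: "z \<in> I" "z \<noteq> i" "z \<noteq> j" for z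
  proof -
    define e where "e = c j - c z"
    have nz: "a \<noteq> 0" "e \<noteq> 0" "a + e \<noteq> 0"
      using c_eq i j z by (auto simp: a_def e_def)
    have "G i j = G j z" "G i z = G j z"
      using G_const[of j i z] G_const[of z i j] G_sym i j z by metis+
    then have 1: "(b i - b j) * a = (b j - b z) * e"
      and 2: "(b i - b z) * (a + e) = (b j - b z) * e"
      by (simp_all add: G_def a_def e_def)
    define g where "g = b j - b z"
    define h where "h = b i - b j"
    have g: "g \<noteq> 0" using b_eq j z by (auto simp: g_def)
    have 3: "h * a = g * e" "(h + g) * (a + e) = g * e"
      using 1 2 by (simp_all add: g_def h_def)
    \<comment> \<open>This combination of the equations
      \<open>h * a = g * e = (h + g) * (a + e)\<close> eliminates \<open>h\<close>; then the nonzero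
      factor \<open>g\<close> is cancelled.\<close>
    have "g * (e ^ 2 + a * e + a ^ 2) = a * ((h + g) * (a + e)) - a * (h * a) - e * (h * a) + g * e * e"
      by (simp add: algebra_simps power2_eq_square)
    also have "\<dots> = 0"
      unfolding 3 by (simp add: algebra_simps)
    finally show ?thesis using g by (simp add: e_def)
  qed
  obtain x where x: "x \<in> I" "x \<noteq> i" "x \<noteq> j" using pick[of "[i, j]"] by auto
  obtain y where y: "y \<in> I" "y \<noteq> i" "y \<noteq> j" "y \<noteq> x" using pick[of "[i, j, x]"] by auto
  obtain z where z: "z \<in> I" "z \<noteq> i" "z \<noteq> j" "z \<noteq> x" "z \<noteq> y" using pick[of "[i, j, x, y]"] by auto
  \<comment> \<open>Subtracting the quadratics of two distinct roots gives their sum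
    \<open>- a\<close>. So the root of \<open>x\<close> determines every other root, which makes
    those of \<open>y\<close> and \<open>z\<close> coincide.\<close>
  have vieta: "(c j - c x) + (c j - c w) + a = 0" if w: "w \<in> I" "w \<noteq> i" "w \<noteq> j" "w \<noteq> x" for w
  proof -
    define p q where "p = c j - c x" and "q = c j - c w"
    have "p - q \<noteq> 0" using c_eq x w by (auto simp: p_def q_def)
    moreover have "(p - q) * (p + q + a) = (p ^ 2 + a * p + a ^ 2) - (q ^ 2 + a * q + a ^ 2)"
      by (simp add: algebra_simps power2_eq_square)
    moreover have "\<dots> = 0"
      using root[of x] root[of w] x w by (simp add: p_def q_def)
    ultimately show ?thesis by (simp add: p_def q_def)
  qed
  have "c y - c z = ((c j - c x) + (c j - c z) + a) - ((c j - c x) + (c j - c y) + a)"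
    by simp
  also have "\<dots> = 0"
    using vieta[of y] vieta[of z] y z by simp
  finally have "c y = c z" by simp
  then show False using c_eq y z by blast
qed

section \<open>Counting antipodes and disjoint lines in an antipodal plane\<close>

lemma ex1_if_Collect_eq_singleton:
  assumes "{y. Q y} = {z}"
  shows "\<exists>!y. Q y"
  using assms by (metis mem_Collect_eq singleton_iff)

locale antipodal =
  fixes s :: nat and P :: "'p set" and L :: "'p set set"
  assumes antipodal_plane: "antipodal_plane s P L"
begin

lemma finite_points: "finite P" and finite_lines: "finite L"
  using antipodal_plane unfolding antipodal_plane_def by (auto intro: card_ge_0_finite)

lemma line_subset: "l \<in> L \<Longrightarrow> l \<subseteq> P"
  using antipodal_plane unfolding antipodal_plane_def partial_linear_space_def by blast

lemma finite_line: "l \<in> L \<Longrightarrow> finite l"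
  using line_subset finite_points finite_subset by blast

lemma line_unique:
  "\<lbrakk>l \<in> L; m \<in> L; x \<in> l; y \<in> l; x \<in> m; y \<in> m; x \<noteq> y\<rbrakk> \<Longrightarrow> l = m"
  using antipodal_plane line_subset
  unfolding antipodal_plane_def partial_linear_space_def by blast

lemma card_line: "l \<in> L \<Longrightarrow> card l = s + 1"
  using antipodal_plane unfolding antipodal_plane_def by blast

lemma card_pencil: "x \<in> P \<Longrightarrow> card {l \<in> L. x \<in> l} = s + 1"
  using antipodal_plane unfolding antipodal_plane_def by blast

lemma card_points: "card P = s * (s + 1) + 2" and card_lines: "card L = s * (s + 1) + 2"
  using antipodal_plane unfolding antipodal_plane_def by (simp_all add: power2_eq_square)

text \<open>The \<open>s + 1\<close> lines through \<open>x\<close> carry \<open>s\<close> further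
  points each, without overlap. Together with \<open>x\<close> this accounts for all points but
  one.\<close>

lemma ex1_antipode:
  assumes x: "x \<in> P"
  shows "\<exists>!y. y \<in> P \<and> y \<noteq> x \<and> (\<forall>l\<in>L. \<not> (x \<in> l \<and> y \<in> l))"
proof -
  define N where "N = (\<Union>l\<in>{l \<in> L. x \<in> l}. l - {x})"
  have "card N = (\<Sum>l\<in>{l \<in> L. x \<in> l}. card (l - {x}))"
    unfolding N_def
  proof (rule card_UN_disjoint)
    show "\<forall>l\<in>{l \<in> L. x \<in> l}. \<forall>m\<in>{l \<in> L. x \<in> l}. l \<noteq> m \<longrightarrow> (l - {x}) \<inter> (m - {x}) = {}"
      using line_unique by blast
  qed (use finite_lines finite_line in auto)
  also have "\<dots> = (\<Sum>l\<in>{l \<in> L. x \<in> l}. s)"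
    by (rule sum.cong) (auto simp: card_line finite_line)
  also have "\<dots> = s * (s + 1)"
    using card_pencil[OF x] by simp
  finally have N: "card N = s * (s + 1)" .
  have sub: "insert x N \<subseteq> P" "x \<notin> N"
    using x line_subset by (auto simp: N_def)
  have finN: "finite N" using sub finite_points finite_subset by auto
  have "card (P - insert x N) = 1"
    using sub finN N card_points by (simp add: card_Diff_subset)
  then obtain y where "P - insert x N = {y}" by (rule card_1_singletonE)
  moreover have "P - insert x N = {y. y \<in> P \<and> y \<noteq> x \<and> (\<forall>l\<in>L. \<not> (x \<in> l \<and> y \<in> l))}"
    by (auto simp: N_def)
  ultimately show ?thesis by (intro ex1_if_Collect_eq_singleton) simp
qed

lemma antipode_unique:
  assumes "x \<in> P" and y: "y \<in> P" "y \<noteq> x" "\<forall>l\<in>L. \<not> (x \<in> l \<and> y \<in> l)"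
    and z: "z \<in> P" "z \<noteq> x" "\<forall>l\<in>L. \<not> (x \<in> l \<and> z \<in> l)"
  shows "y = z"
  using ex1_antipode[OF assms(1)]
proof (rule ex1E)
  fix w assume w: "\<forall>y. y \<in> P \<and> y \<noteq> x \<and> (\<forall>l\<in>L. \<not> (x \<in> l \<and> y \<in> l)) \<longrightarrow> y = w"
  have "y = w" "z = w"
    by (rule w[THEN spec, THEN mp], use y z in simp)+
  then show ?thesis by simp
qed

text \<open>Dual count: each of the \<open>s + 1\<close> points of \<open>l\<close> lies on
  \<open>s\<close> further lines, so \<open>l\<close> and the lines meeting it are all lines but
  one.\<close>

lemma ex1_disjoint_line:
  assumes l: "l \<in> L"
  shows "\<exists>!m. m \<in> L \<and> l \<inter> m = {}"
proof -
  define N where "N = (\<Union>x\<in>l. {m \<in> L. x \<in> m} - {l})"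
  have "card N = (\<Sum>x\<in>l. card ({m \<in> L. x \<in> m} - {l}))"
    unfolding N_def
  proof (rule card_UN_disjoint)
    show "\<forall>x\<in>l. \<forall>y\<in>l. x \<noteq> y \<longrightarrow> ({m \<in> L. x \<in> m} - {l}) \<inter> ({m \<in> L. y \<in> m} - {l}) = {}"
      using line_unique l by blast
  qed (use finite_lines finite_line l in auto)
  also have "\<dots> = (\<Sum>x\<in>l. s)"
  proof (rule sum.cong)
    fix x assume "x \<in> l"
    then have "x \<in> P" "l \<in> {m \<in> L. x \<in> m}" using l line_subset by auto
    then show "card ({m \<in> L. x \<in> m} - {l}) = s"
      using card_pencil finite_lines by simp
  qed simp
  also have "\<dots> = s * (s + 1)"
    using card_line[OF l] by simp
  finally have N: "card N = s * (s + 1)" .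
  have sub: "insert l N \<subseteq> L" "l \<notin> N"
    using l by (auto simp: N_def)
  have finN: "finite N" using sub finite_lines finite_subset by auto
  have "card (L - insert l N) = 1"
    using sub finN N card_lines by (simp add: card_Diff_subset)
  then obtain m where "L - insert l N = {m}" by (rule card_1_singletonE)
  \<comment> \<open>An empty \<open>l\<close> would be disjoint from itself.\<close>
  moreover have "l \<noteq> {}" using card_line[OF l] by auto
  then have "L - insert l N = {m. m \<in> L \<and> l \<inter> m = {}}"
    by (auto simp: N_def)
  ultimately show ?thesis by (intro ex1_if_Collect_eq_singleton) simp
qed

text \<open>Otherwise the \<open>s + 1\<close> points of \<open>m\<close> would be joined to
  \<open>x\<close> by distinct lines, since two on one line would force that line to be
  \<open>m\<close>, which misses \<open>x\<close>. But only \<open>s\<close> lines through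
  \<open>x\<close> differ from \<open>l\<close>.\<close>

lemma antipode_in_disjoint_line:
  assumes "l \<in> L" "m \<in> L" "l \<inter> m = {}" "x \<in> l"
  shows "\<exists>y\<in>m. y \<noteq> x \<and> (\<forall>k\<in>L. \<not> (x \<in> k \<and> y \<in> k))"
proof (rule ccontr)
  assume contra: "\<not> ?thesis"
  have xm: "x \<notin> m" using assms by blast
  have "\<exists>k\<in>L. x \<in> k \<and> y \<in> k" if "y \<in> m" for y
  proof -
    have "y \<noteq> x" using xm that by auto
    then show ?thesis using contra that by meson
  qed
  then obtain f where f: "\<forall>y\<in>m. f y \<in> L \<and> x \<in> f y \<and> y \<in> f y" by metis
  have "inj_on f m"
  proof (rule inj_onI, rule ccontr)
    fix y z assume yz: "y \<in> m" "z \<in> m" "f y = f z" "y \<noteq> z"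
    then have "f y = m" using line_unique[of "f y" m y z] f assms by metis
    then show False using f yz xm by blast
  qed
  moreover have "f ` m \<subseteq> {k \<in> L. x \<in> k} - {l}"
    using f assms by auto
  ultimately have "card m \<le> card ({k \<in> L. x \<in> k} - {l})"
    using finite_lines by (intro card_inj_on_le[of f]) auto
  moreover have "card ({k \<in> L. x \<in> k} - {l}) = s"
    using card_pencil[of x] line_subset[of l] assms finite_lines
    by (subst card_Diff_singleton) auto
  ultimately show False using card_line assms by simp
qed

end

section \<open>Linear algebra of points and lines of PG(2,K)\<close>

text \<open>A plane missing \<open>f\<close> is a complement of the span of \<open>f\<close> in
  3-space. This supplies the affine coordinates.\<close>

lemma plane_meets_translate:
  fixes W :: "('k::field ^ 3) set"
  assumes W: "vec.subspace W" "vec.dim W = 2" and f: "f \<notin> W"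
  shows "\<exists>t. g + t *s f \<in> W"
proof -
  have "vec.dim (insert f W) = 3"
    using W f by (simp add: vec.dim_insert vec.span_eq_iff[THEN iffD2])
  then have "vec.span (insert f W) = UNIV"
    by (intro vec.dim_eq_full[THEN iffD1]) (simp add: vec.dimension_def card_cart_basis)
  then have "g \<in> vec.span (insert f W)" by simp
  then obtain t where "g - t *s f \<in> vec.span W"
    using vec.span_breakdown_eq by blast
  then have "g + (- t) *s f \<in> W"
    using W by (simp add: vec.span_eq_iff[THEN iffD2])
  then show ?thesis by blast
qed

text \<open>Distinct planes through the origin meet in dimension at most 1, so a common
  1-dimensional subspace fills the intersection.\<close>

lemma point_eq_Int_lines:
  fixes U :: "('k::field ^ 3) set"
  assumes "U \<in> pg2_points" "W \<in> pg2_lines" "W' \<in> pg2_lines" "W \<noteq> W'" "U \<subseteq> W" "U \<subseteq> W'"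
  shows "U = W \<inter> W'"
proof (rule vec.subspace_dim_equal)
  have sub: "vec.subspace W" "vec.subspace W'" "vec.dim W = 2" "vec.dim W' = 2"
    using assms by (auto simp: pg2_lines_def)
  show int: "vec.subspace (W \<inter> W')" using sub by (simp add: vec.subspace_inter)
  have "vec.dim (W \<inter> W') \<noteq> 2"
  proof
    assume "vec.dim (W \<inter> W') = 2"
    then have "W \<inter> W' = W" "W \<inter> W' = W'"
      using vec.subspace_dim_equal[OF int] sub by auto
    then show False using assms by simp
  qed
  moreover have "vec.dim (W \<inter> W') \<le> 2"
    using vec.dim_subset[of "W \<inter> W'" W] sub by simp
  ultimately show "vec.dim (W \<inter> W') \<le> vec.dim U"
    using assms by (simp add: pg2_points_def)
qed (use assms in \<open>auto simp: pg2_points_def\<close>)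

lemma point_vector:
  assumes "U \<in> (pg2_points :: ('k::field ^ 3) set set)"
  shows "\<exists>e. U = vec.span {e}"
proof -
  have U: "vec.subspace U" "vec.dim U = 1" using assms by (auto simp: pg2_points_def)
  obtain B where B: "B \<subseteq> U" "vec.independent B" "U \<subseteq> vec.span B" "card B = vec.dim U"
    using vec.basis_exists by blast
  then obtain e where "B = {e}" using U by (metis card_1_singletonE)
  then show ?thesis using B U vec.span_minimal by blast
qed

section \<open>Coordinates for the embedded plane and reduction to the grid\<close>

theorem mainTheorem3:
  fixes s :: nat and P :: "'p set" and L :: "'p set set"
  assumes "s \<ge> 4"
    and "antipodal_plane s P L"
  shows "\<not> embedded_in P L
           (pg2_points :: ('k::{field,finite} ^ 3) set set)
           (pg2_lines :: ('k ^ 3) set set) (\<subseteq>)"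
proof
  assume "embedded_in P L (pg2_points :: ('k ^ 3) set set) (pg2_lines :: ('k ^ 3) set set) (\<subseteq>)"
  then obtain \<phi> :: "'p \<Rightarrow> ('k ^ 3) set" and \<psi> :: "'p set \<Rightarrow> ('k ^ 3) set"
    where emb: "\<phi> ` P \<subseteq> pg2_points" "\<psi> ` L \<subseteq> pg2_lines" and inj_\<psi>: "inj_on \<psi> L"
      and incid: "\<forall>x\<in>P. \<forall>l\<in>L. \<phi> x \<subseteq> \<psi> l \<longleftrightarrow> x \<in> l"
    unfolding embedded_in_def by (elim exE conjE) (rule that)
  have \<phi>: "\<And>x. x \<in> P \<Longrightarrow> \<phi> x \<in> pg2_points" and \<psi>: "\<And>l. l \<in> L \<Longrightarrow> \<psi> l \<in> pg2_lines"
    using emb by auto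
  have inc: "\<phi> x \<subseteq> \<psi> l \<longleftrightarrow> x \<in> l" if "x \<in> P" "l \<in> L" for x l
    using incid that by simp
  interpret antipodal s P L by unfold_locales (rule assms(2))

  have subsp: "vec.subspace (\<psi> l)" and dim2: "vec.dim (\<psi> l) = 2" if "l \<in> L" for l
    using \<psi>[OF that] by (auto simp: pg2_lines_def)

  obtain opp where opp: "\<And>l. l \<in> L \<Longrightarrow> opp l \<in> L" "\<And>l. l \<in> L \<Longrightarrow> l \<inter> opp l = {}"
    and opp_unique: "\<And>l m. l \<in> L \<Longrightarrow> m \<in> L \<Longrightarrow> l \<inter> m = {} \<Longrightarrow> m = opp l"
    using ex1_disjoint_line by metis
  have opp_opp: "opp (opp l) = l" if "l \<in> L" for l
    using opp_unique[of "opp l" l] opp[of l] that by blast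

  have "P \<noteq> {}" using card_points by auto
  then obtain a where a: "a \<in> P" by blast
  obtain a' where a'_all: "a' \<in> P \<and> a' \<noteq> a \<and> (\<forall>l\<in>L. \<not> (a \<in> l \<and> a' \<in> l))"
    using ex1_antipode[OF a] by (rule ex1E)
  then have a': "a' \<in> P" "a' \<noteq> a" "\<And>l. l \<in> L \<Longrightarrow> \<not> (a \<in> l \<and> a' \<in> l)"
    by auto
  have a'_unique: "y = a'" if "y \<in> P" "y \<noteq> a" "\<forall>l\<in>L. \<not> (a \<in> l \<and> y \<in> l)" for y
    using antipode_unique[of a y a'] a a'_all that by simp
  define I where "I = {l \<in> L. a \<in> l}"
  have I_L: "l \<in> L" and I_a: "a \<in> l" and I_a': "a' \<notin> l" if "l \<in> I" for l
    using that a' by (auto simp: I_def)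
  \<comment> \<open>The antipode of \<open>a\<close> on \<open>opp l\<close> must be
    \<open>a'\<close>, so the lines \<open>opp l\<close> pass through \<open>a'\<close>.\<close>
  have opp_a': "a' \<in> opp l" and opp_a: "a \<notin> opp l" if l: "l \<in> I" for l
  proof -
    obtain y where "y \<in> opp l" "y \<noteq> a" "\<forall>k\<in>L. \<not> (a \<in> k \<and> y \<in> k)"
      using antipode_in_disjoint_line[of l "opp l" a] opp[of l] I_L I_a l by blast
    then show "a' \<in> opp l"
      using a'_unique[of y] line_subset[of "opp l"] opp(1)[of l] I_L l by auto
    show "a \<notin> opp l" using opp(2)[of l] I_L I_a l by auto
  qed

  obtain e where e: "\<phi> a = vec.span {e}" using point_vector \<phi> a by blast
  obtain f where f: "\<phi> a' = vec.span {f}" using point_vector \<phi> a' by blast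
  have e_in: "e \<in> \<psi> l \<longleftrightarrow> a \<in> l" if "l \<in> L" for l
    unfolding inc[OF a that, symmetric] e
    using vec.span_minimal[of "{e}" "\<psi> l"] subsp[OF that] vec.span_base[of e "{e}"] by blast
  have f_in: "f \<in> \<psi> l \<longleftrightarrow> a' \<in> l" if "l \<in> L" for l
    unfolding inc[OF a'(1) that, symmetric] f
    using vec.span_minimal[of "{f}" "\<psi> l"] subsp[OF that] vec.span_base[of f "{f}"] by blast
  have "vec.span {e, f} \<noteq> UNIV"
  proof
    assume "vec.span {e, f} = UNIV"
    moreover have "vec.dim (UNIV :: ('k ^ 3) set) = 3"
      by (simp add: vec.dimension_def card_cart_basis)
    ultimately have "vec.dim {e, f} = 3"
      using vec.dim_span[of "{e, f}"] by simp
    moreover have "vec.dim {e, f} \<le> card {e, f}" by (rule vec.dim_le_card') simp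
    moreover have "card {e, f} \<le> 2" by (simp add: card_insert_if)
    ultimately show False by simp
  qed
  \<comment> \<open>With the span of \<open>e\<close> and \<open>f\<close> in the role of the line
    at infinity, \<open>g\<close> is the affine origin: the point (c, b) is spanned by g + c e + b
    f.\<close>
  then obtain g where g: "g \<notin> vec.span {e, f}" by blast

  have "\<exists>t. g + t *s f \<in> \<psi> l" if "l \<in> I" for l
    using plane_meets_translate[OF subsp dim2] f_in I_L I_a' that by blast
  then obtain b where b: "\<And>l. l \<in> I \<Longrightarrow> g + b l *s f \<in> \<psi> l" by metis
  have "\<exists>t. g + t *s e \<in> \<psi> (opp l)" if "l \<in> I" for l
    using plane_meets_translate[OF subsp dim2] e_in I_L opp opp_a that by blast
  then obtain c where c: "\<And>l. l \<in> I \<Longrightarrow> g + c l *s e \<in> \<psi> (opp l)" by metis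

  have "inj_on b I"
  proof (rule inj_onI, rule ccontr)
    \<comment> \<open>Two lines through \<open>a\<close> of equal height would share an affine
      point, although they meet only in \<open>\<phi> a\<close>, at infinity.\<close>
    fix l m assume lm: "l \<in> I" "m \<in> I" "b l = b m" "l \<noteq> m"
    then have "\<psi> l \<noteq> \<psi> m" using inj_\<psi> I_L by (meson inj_onD)
    then have "\<phi> a = \<psi> l \<inter> \<psi> m"
      using lm \<phi> \<psi> I_L I_a a inc by (intro point_eq_Int_lines) auto
    then have "g + b l *s f \<in> vec.span {e, f}"
      using b[of l] b[of m] lm e vec.span_mono[of "{e}" "{e, f}"] by auto
    then have "g + b l *s f - b l *s f \<in> vec.span {e, f}"
      by (intro vec.span_diff vec.span_scale) (auto intro: vec.span_base)
    then show False using g by simp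
  qed
  have "inj_on c I"
  proof (rule inj_onI, rule ccontr)
    fix l m assume lm: "l \<in> I" "m \<in> I" "c l = c m" "l \<noteq> m"
    then have "opp l \<noteq> opp m" using opp_opp I_L by metis
    then have "\<psi> (opp l) \<noteq> \<psi> (opp m)" using inj_\<psi> I_L opp lm by (meson inj_onD)
    then have "\<phi> a' = \<psi> (opp l) \<inter> \<psi> (opp m)"
      using lm \<phi> \<psi> I_L opp opp_a' a' inc by (intro point_eq_Int_lines) auto
    then have "g + c l *s e \<in> vec.span {e, f}"
      using c[of l] c[of m] lm f vec.span_mono[of "{f}" "{e, f}"] by auto
    then have "g + c l *s e - c l *s e \<in> vec.span {e, f}"
      by (intro vec.span_diff vec.span_scale) (auto intro: vec.span_base)
    then show False using g by simp
  qed

  \<comment> \<open>The displayed vector lies in both planes \<open>\<psi> (opp l)\<close> and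
    \<open>\<psi> m\<close>, hence in their intersection \<open>\<phi> p\<close>, hence in every
    line through \<open>p\<close>.\<close>
  have coords: "g + c l *s e + b m *s f \<in> \<psi> n"
    if h: "l \<in> I" "m \<in> I" "p \<in> opp l" "p \<in> m" "n \<in> L" "p \<in> n" for l m p n
  proof -
    have p: "p \<in> P" using line_subset I_L h by blast
    have "opp l \<noteq> m" using opp_a I_a h by blast
    then have "\<psi> (opp l) \<noteq> \<psi> m" using inj_\<psi> I_L opp h by (meson inj_onD)
    then have "\<phi> p = \<psi> (opp l) \<inter> \<psi> m"
      using h \<phi> \<psi> I_L opp p inc by (intro point_eq_Int_lines) auto
    moreover have "f \<in> \<psi> (opp l)" "e \<in> \<psi> m"
      using f_in e_in opp_a' I_a I_L opp h by auto
    then have "g + c l *s e + b m *s f \<in> \<psi> (opp l)" "g + b m *s f + c l *s e \<in> \<psi> m"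
      using b[of m] c[of l] h subsp I_L opp
      by (auto intro!: vec.subspace_add vec.subspace_scale)
    ultimately have "g + c l *s e + b m *s f \<in> \<phi> p" by (simp add: add.assoc add.commute add.left_commute)
    then show ?thesis using inc p h by blast
  qed

  have "card I \<le> 4"
  proof (rule affine_grid_card_le_4[OF \<open>inj_on c I\<close> \<open>inj_on b I\<close>])
    fix x y u v
    assume h: "x \<in> I" "y \<in> I" "u \<in> I" "v \<in> I" "x \<noteq> y" "u \<noteq> v" "x \<noteq> u" "y \<noteq> v" "\<not> (x = v \<and> y = u)"
    have L: "x \<in> L" "y \<in> L" "u \<in> L" "v \<in> L" "opp x \<in> L" "opp y \<in> L" "opp u \<in> L" "opp v \<in> L"
      using h I_L opp by auto
    \<comment> \<open>The only line disjoint from \<open>opp l\<close> is \<open>l\<close> itself,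
      so every grid position off the diagonal is occupied.\<close>
    have meet: "\<exists>p. p \<in> opp l \<and> p \<in> m" if "l \<in> L" "m \<in> L" "l \<noteq> m" for l m
      using opp_unique[of "opp l" m] opp_opp[of l] opp that by blast
    obtain p where p: "p \<in> opp x" "p \<in> y" using meet[of x y] L h by blast
    obtain q where q: "q \<in> opp u" "q \<in> v" using meet[of u v] L h by blast
    have opp_ne: "opp x \<noteq> opp u" using opp_opp[OF L(1)] opp_opp[OF L(3)] h by metis
    have pq_ne: "p \<noteq> a" "p \<noteq> a'" "q \<noteq> a" "q \<noteq> a'"
      using p q h opp_a I_a' by auto
    have "p \<noteq> q"
      using line_unique[of "opp x" "opp u" p a'] L p q h opp_a' opp_ne pq_ne by blast
    have pP: "p \<in> P" "q \<in> P" using p q L line_subset by auto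
    have "\<exists>n\<in>L. p \<in> n \<and> q \<in> n"
    proof (rule ccontr)
      assume contra: "\<not> ?thesis"
      \<comment> \<open>If not joined, \<open>q\<close> is the antipode of \<open>p\<close>, so it
        lies on both \<open>opp y\<close> and \<open>x\<close>. Comparing with \<open>opp u\<close>
        through \<open>a'\<close> and \<open>v\<close> through \<open>a\<close> gives the excluded
        case \<open>y = u\<close>, \<open>x = v\<close>.\<close>
      then have q_anti: "q' = q" if "q' \<in> P" "q' \<noteq> p" "\<forall>k\<in>L. \<not> (p \<in> k \<and> q' \<in> k)" for q'
        using antipode_unique[of p q' q] pP \<open>p \<noteq> q\<close> that by simp
      have "q \<in> opp y"
        using antipode_in_disjoint_line[of y "opp y" p] L p opp(2)[of y] q_anti
          line_subset[of "opp y"] by auto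
      then have "opp y = opp u"
        using line_unique[of "opp y" "opp u" q a'] L q h opp_a' pq_ne by blast
      then have "y = u" using opp_opp L by metis
      have "q \<in> x"
        using antipode_in_disjoint_line[of "opp x" x p] L p opp(2)[of x] q_anti
          line_subset[of x] by auto
      then have "x = v"
        using line_unique[of x v q a] L q h I_a pq_ne by blast
      then show False using h \<open>y = u\<close> by blast
    qed
    then obtain n where n: "n \<in> L" "p \<in> n" "q \<in> n" by blast
    have an: "a \<notin> n"
      using line_unique[of n y a p] line_unique[of n v a q] n L p q h I_a pq_ne by blast
    have a'n: "a' \<notin> n"
      using line_unique[of n "opp x" a' p] line_unique[of n "opp u" a' q] n L p q h opp_a' pq_ne opp_ne
      by blast
    define r where "r = (b v - b y) / (c u - c x)"
    define m where "m = b y - r * c x"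
    have "c u - c x \<noteq> 0" using \<open>inj_on c I\<close> h by (auto dest: inj_onD)
    then have "r * (c u - c x) = b v - b y" by (simp add: r_def)
    moreover have "r * c u + m = r * (c u - c x) + b y" by (simp add: m_def algebra_simps)
    ultimately have rm: "r * c x + m = b y" "r * c u + m = b v" by (simp_all add: m_def)
    have "\<exists>w\<in>I. w \<noteq> z \<and> r * c z + m = b w" if z: "z \<in> I" for z
    proof -
      \<comment> \<open>The point \<open>t\<close> of \<open>n\<close> in column \<open>z\<close> is
        not \<open>a'\<close>, so some \<open>w\<close> joins it to \<open>a\<close>. As
        \<open>opp z\<close> misses \<open>z\<close>, this row differs from
        \<open>z\<close>.\<close>
      have "n \<noteq> z" using an I_a z by blast
      then obtain t where t: "t \<in> opp z" "t \<in> n" using meet[of z n] I_L z n by blast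
      have tP: "t \<in> P" "t \<noteq> a" "t \<noteq> a'" using t n line_subset an a'n by auto
      then obtain w where w: "w \<in> L" "a \<in> w" "t \<in> w" using a'_unique[of t] by auto
      have wI: "w \<in> I" using w by (simp add: I_def)
      have wz: "w \<noteq> z" using w t opp I_L z by blast
      \<comment> \<open>The parameter \<open>\<delta>\<close> makes the \<open>e\<close>-coordinate
        of \<open>T - A - \<delta> *s (B - A)\<close> vanish. What remains is a multiple of
        \<open>f\<close> in \<open>\<psi> n\<close>, and it is zero because \<open>a'\<close> is not
        on \<open>n\<close>.\<close>
      define \<delta> where "\<delta> = (c z - c x) / (c u - c x)"
      define A where "A = g + c x *s e + b y *s f"
      define B where "B = g + c u *s e + b v *s f"
      define T where "T = g + c z *s e + b w *s f"
      have in_n: "A \<in> \<psi> n" "B \<in> \<psi> n" "T \<in> \<psi> n"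
        unfolding A_def B_def T_def using coords p q t h z wI w n by blast+
      have d1: "\<delta> * (c u - c x) = c z - c x"
        using \<open>c u - c x \<noteq> 0\<close> by (simp add: \<delta>_def)
      have d2: "\<delta> * (b v - b y) = r * c z + m - b y"
      proof -
        have "\<delta> * (b v - b y) = r * (c z - c x)" by (simp add: \<delta>_def r_def)
        then show ?thesis by (simp add: m_def algebra_simps)
      qed
      have "T - A - \<delta> *s (B - A) =
          (c z - c x - \<delta> * (c u - c x)) *s e + (b w - b y - \<delta> * (b v - b y)) *s f"
        by (simp add: A_def B_def T_def vec_eq_iff algebra_simps)
      also have "\<dots> = (b w - (r * c z + m)) *s f"
        unfolding d1 d2 by (simp add: algebra_simps)
      finally have "(b w - (r * c z + m)) *s f \<in> \<psi> n"
        using in_n subsp[OF n(1)] by (metis vec.subspace_diff vec.subspace_scale)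
      then have "b w - (r * c z + m) = 0"
        using a'n f_in[OF n(1)] vec.subspace_scale[OF subsp[OF n(1)], of _ "inverse (b w - (r * c z + m))"]
        by (metis left_inverse vec.scale_one vec.scale_scale)
      then show ?thesis using wI wz by auto
    qed
    then show "\<exists>r m. r * c x + m = b y \<and> r * c u + m = b v \<and>
        (\<forall>z\<in>I. \<exists>w\<in>I. w \<noteq> z \<and> r * c z + m = b w)"
      using rm by blast
  qed
  then show False using card_pencil[OF a] assms(1) by (simp add: I_def)
qed

end
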